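(* Every bounded pure residuated multilattice has at least seven elements.
   Context: Let $(P,\le)$ be a poset. For $X\subseteq P$, $\sqcup X$ denotes the set of minimal upper bounds of $X$ and $\sqcap X$ the set of maximal lower bounds of $X$. The poset $(P,\le)$ is a multilattice if for every finite subset $X$ of $P$, each upper bound of $X$ is above ($\geq$) some element of $\sqcup X$ and each lower bound of $X$ is below ($\leq$) some element of $\sqcap X$. A multilattice is pure if it is not a lattice. A pocrim is a structure $(A,\le,\top,\odot,\to)$ where $(A,\le,\top)$ is a poset with greatest element $\top$, $(A,\odot,\top)$ is a commutative monoid, and for all $a,b,c\in A$: $a\odot c\le b\iff c\le a\to b$. It is bounded if it also has a least element $\bot$. A residuated multilattice is a pocrim whose underlying poset is a multilattice; it is pure if that multilattice is pure (i.e. is not a lattice). *)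

theory Defs
  imports "HOL-Algebra.Group"
begin

definition minimal_upper_bounds :: "('a, 'b) gorder_scheme \<Rightarrow> 'a set \<Rightarrow> 'a set" where
  "minimal_upper_bounds L X =
     {u \<in> Upper L X. \<forall>v \<in> Upper L X. v \<sqsubseteq>\<^bsub>L\<^esub> u \<longrightarrow> v = u}"

definition maximal_lower_bounds :: "('a, 'b) gorder_scheme \<Rightarrow> 'a set \<Rightarrow> 'a set" where
  "maximal_lower_bounds L X =
     {l \<in> Lower L X. \<forall>v \<in> Lower L X. l \<sqsubseteq>\<^bsub>L\<^esub> v \<longrightarrow> v = l}"

locale multilattice = partial_order L for L (structure) +
  assumes above_minimal_upper_bound:
      "\<lbrakk>finite X; X \<subseteq> carrier L; u \<in> Upper L X\<rbrakk>
        \<Longrightarrow> \<exists>m \<in> minimal_upper_bounds L X. m \<sqsubseteq> u"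
    and below_maximal_lower_bound:
      "\<lbrakk>finite X; X \<subseteq> carrier L; l \<in> Lower L X\<rbrakk>
        \<Longrightarrow> \<exists>m \<in> maximal_lower_bounds L X. l \<sqsubseteq> m"

locale pure_multilattice = multilattice L for L (structure) +
  assumes not_lattice: "\<not> lattice L"

record 'a pocrim = "'a gorder" +
  top_elem :: 'a
  prod_op :: "'a \<Rightarrow> 'a \<Rightarrow> 'a" (infixl \<open>\<odot>\<index>\<close> 70)
  residuum :: "'a \<Rightarrow> 'a \<Rightarrow> 'a" (infixr \<open>\<rightarrow>\<index>\<close> 65)

locale pocrim = partial_order A for A (structure) +
  assumes top_elem_greatest: "greatest A (top_elem A) (carrier A)"
    and prod_comm_monoid:
      "comm_monoid \<lparr>carrier = carrier A, mult = prod_op A, one = top_elem A\<rparr>"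
    and residuum_closed: "\<lbrakk>a \<in> carrier A; b \<in> carrier A\<rbrakk> \<Longrightarrow> a \<rightarrow> b \<in> carrier A"
    and residuation:
      "\<lbrakk>a \<in> carrier A; b \<in> carrier A; c \<in> carrier A\<rbrakk>
        \<Longrightarrow> (a \<odot> c) \<sqsubseteq> b \<longleftrightarrow> c \<sqsubseteq> (a \<rightarrow> b)"

locale bounded_pocrim = pocrim A + weak_partial_order_bottom A for A (structure)

locale residuated_multilattice = pocrim A + multilattice A for A (structure)

locale pure_residuated_multilattice =
  residuated_multilattice A + pure_multilattice A for A (structure)

locale bounded_pure_residuated_multilattice =
  bounded_pocrim A + pure_residuated_multilattice A for A (structure)

end

theory Submission
  imports Defs
begin

text \<open>
  A bounded multilattice that is not a lattice contains a crown: incomparable \<open>a\<close>, \<open>b\<close>, both below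
  incomparable \<open>c\<close>, \<open>d\<close>. (If \<open>{a, b}\<close> has no join, take two of its minimal upper bounds as \<open>c\<close>,
  \<open>d\<close>; if \<open>{c, d}\<close> has no meet, take two of its maximal lower bounds as \<open>a\<close>, \<open>b\<close>.) With the two
  bounds this makes six elements, so a counterexample to the theorem would consist of exactly
  \<open>\<bottom> < a, b < c, d < \<top>\<close>. What remains is to show that this poset carries no residuated structure.

  The product is monotone and lies below both factors, so \<open>a \<odot> b = \<bottom>\<close>. The heart of the proof is
  that the atoms are idempotent. The elements \<open>x\<close> with \<open>a \<odot> x = \<bottom>\<close> form a principal ideal, namely
  the one generated by \<open>a \<rightarrow> \<bottom>\<close>; it contains \<open>b\<close>, and if \<open>a \<odot> a = \<bottom>\<close> then it contains
  \<open>a\<close> too, so that \<open>a \<rightarrow> \<bottom>\<close> is \<open>c\<close> or \<open>d\<close>. Lemma \<open>residuum_bottom_neq\<close> excludes both by computing a few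
  products. Once \<open>a \<odot> a = a\<close> and \<open>b \<odot> b = b\<close>, monotonicity puts \<open>c \<odot> d\<close> above \<open>a\<close> and \<open>b\<close>, while it
  is also below \<open>c\<close> and \<open>d\<close>; no element lies in that gap.
\<close>

section \<open>The product of a pocrim\<close>

context pocrim
begin

lemma top_in_carrier: "top_elem A \<in> carrier A"
  using top_elem_greatest by (rule greatest_closed)

lemma le_top: "x \<in> carrier A \<Longrightarrow> x \<sqsubseteq> top_elem A"
  using top_elem_greatest by (rule greatest_le)

lemma prod_closed: "\<lbrakk>x \<in> carrier A; y \<in> carrier A\<rbrakk> \<Longrightarrow> x \<odot> y \<in> carrier A"
  using comm_monoid.axioms(1)[OF prod_comm_monoid] monoid.m_closed by fastforce

lemma prod_comm: "\<lbrakk>x \<in> carrier A; y \<in> carrier A\<rbrakk> \<Longrightarrow> x \<odot> y = y \<odot> x"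
  using comm_monoid.m_comm[OF prod_comm_monoid] by simp

lemma prod_top: "x \<in> carrier A \<Longrightarrow> x \<odot> top_elem A = x"
  using comm_monoid.axioms(1)[OF prod_comm_monoid] monoid.r_one by fastforce

lemma prod_mono_right:
  assumes "x \<in> carrier A" "y \<in> carrier A" "z \<in> carrier A" "y \<sqsubseteq> z"
  shows "x \<odot> y \<sqsubseteq> x \<odot> z"
proof -
  have "z \<sqsubseteq> x \<rightarrow> (x \<odot> z)"
    using assms residuation[of x "x \<odot> z" z] by (simp add: prod_closed)
  then have "y \<sqsubseteq> x \<rightarrow> (x \<odot> z)"
    using assms by (blast intro: le_trans prod_closed residuum_closed)
  then show ?thesis
    using assms by (simp add: residuation prod_closed)
qed

lemma prod_mono:
  assumes "x \<in> carrier A" "y \<in> carrier A" "x' \<in> carrier A" "y' \<in> carrier A"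
    and "x \<sqsubseteq> x'" "y \<sqsubseteq> y'"
  shows "x \<odot> y \<sqsubseteq> x' \<odot> y'"
proof (rule le_trans)
  show "x \<odot> y \<sqsubseteq> x \<odot> y'"
    using assms by (intro prod_mono_right)
  show "x \<odot> y' \<sqsubseteq> x' \<odot> y'"
    using assms by (simp add: prod_comm[of _ y'] prod_mono_right)
qed (use assms prod_closed in auto)

lemma prod_le_left: "\<lbrakk>x \<in> carrier A; y \<in> carrier A\<rbrakk> \<Longrightarrow> x \<odot> y \<sqsubseteq> x"
  using prod_mono_right[of x y "top_elem A"] by (simp add: prod_top le_top top_in_carrier)

lemma prod_le_right: "\<lbrakk>x \<in> carrier A; y \<in> carrier A\<rbrakk> \<Longrightarrow> x \<odot> y \<sqsubseteq> y"
  using prod_le_left[of y x] by (simp add: prod_comm)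

end

section \<open>Crowns\<close>

text \<open>Failure of the lattice property produces this configuration in either of two dual ways; since
  it does not mention minimality or maximality of the bounds, both ways lead to the same case.\<close>

locale crown = partial_order L for L (structure) +
  fixes a b c d
  assumes crown_carrier: "a \<in> carrier L" "b \<in> carrier L" "c \<in> carrier L" "d \<in> carrier L"
    and below: "a \<sqsubseteq> c" "a \<sqsubseteq> d" "b \<sqsubseteq> c" "b \<sqsubseteq> d"
    and incomparable: "\<not> a \<sqsubseteq> b" "\<not> b \<sqsubseteq> a" "\<not> c \<sqsubseteq> d" "\<not> d \<sqsubseteq> c"

context multilattice
begin

lemma crown_if_no_join:
  assumes "x \<in> carrier L" "y \<in> carrier L" and t: "t \<in> Upper L {x, y}"
    and no_join: "\<nexists>s. least L s (Upper L {x, y})"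
  shows "\<exists>a b c d. crown L a b c d"
proof -
  obtain c where c: "c \<in> minimal_upper_bounds L {x, y}"
    using assms above_minimal_upper_bound[of "{x, y}" t] by auto
  then have "c \<in> Upper L {x, y}"
    by (simp add: minimal_upper_bounds_def)
  with no_join obtain v where v: "v \<in> Upper L {x, y}" "\<not> c \<sqsubseteq> v"
    by (auto simp: least_def Upper_def)
  then obtain d where d: "d \<in> minimal_upper_bounds L {x, y}" "d \<sqsubseteq> v"
    using assms above_minimal_upper_bound[of "{x, y}" v] by auto
  have "c \<noteq> d"
    using v d by auto
  moreover have "\<not> x \<sqsubseteq> y" "\<not> y \<sqsubseteq> x"
    using no_join assms least_UpperI[of "{x, y}" L x] least_UpperI[of "{x, y}" L y] by auto
  ultimately have "crown L x y c d"
    using c d assms by unfold_locales (auto simp: minimal_upper_bounds_def Upper_def)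
  then show ?thesis by blast
qed

lemma crown_if_no_meet:
  assumes "x \<in> carrier L" "y \<in> carrier L" and t: "t \<in> Lower L {x, y}"
    and no_meet: "\<nexists>s. greatest L s (Lower L {x, y})"
  shows "\<exists>a b c d. crown L a b c d"
proof -
  obtain a where a: "a \<in> maximal_lower_bounds L {x, y}"
    using assms below_maximal_lower_bound[of "{x, y}" t] by auto
  then have "a \<in> Lower L {x, y}"
    by (simp add: maximal_lower_bounds_def)
  with no_meet obtain v where v: "v \<in> Lower L {x, y}" "\<not> v \<sqsubseteq> a"
    by (auto simp: greatest_def Lower_def)
  then obtain b where b: "b \<in> maximal_lower_bounds L {x, y}" "v \<sqsubseteq> b"
    using assms below_maximal_lower_bound[of "{x, y}" v] by auto
  have "a \<noteq> b"
    using v b by auto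
  moreover have "\<not> x \<sqsubseteq> y" "\<not> y \<sqsubseteq> x"
    using no_meet assms greatest_LowerI[of "{x, y}" L x] greatest_LowerI[of "{x, y}" L y] by auto
  ultimately have "crown L a b x y"
    using a b assms by unfold_locales (auto simp: maximal_lower_bounds_def Lower_def)
  then show ?thesis by blast
qed

end

lemma (in bounded_pure_residuated_multilattice) exists_crown: "\<exists>a b c d. crown A a b c d"
proof (rule ccontr)
  assume no_crown: "\<nexists>a b c d. crown A a b c d"
  have "\<exists>s. least A s (Upper A {x, y})" if "x \<in> carrier A" "y \<in> carrier A" for x y
  proof -
    have "top_elem A \<in> Upper A {x, y}"
      using that by (auto intro: Upper_memI le_top top_in_carrier)
    with crown_if_no_join that no_crown show ?thesis by blast
  qed
  moreover have "\<exists>s. greatest A s (Lower A {x, y})" if "x \<in> carrier A" "y \<in> carrier A" for x y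
  proof -
    have "\<bottom> \<in> Lower A {x, y}"
      using that by (auto intro: Lower_memI bottom_lower)
    with crown_if_no_meet that no_crown show ?thesis by blast
  qed
  ultimately have "lattice A"
    by unfold_locales
  then show False
    using not_lattice by contradiction
qed

section \<open>A bounded crown carries no residuated structure\<close>

locale six_element_pocrim = bounded_pocrim A + crown A a b c d for A (structure) and a b c d +
  assumes carrier_eq: "carrier A = {\<bottom>, a, b, c, d, top_elem A}"
begin

lemma swap_lower: "six_element_pocrim A b a c d"
  using crown_carrier below incomparable carrier_eq by unfold_locales auto

lemma swap_upper: "six_element_pocrim A a b d c"
  using crown_carrier below incomparable carrier_eq by unfold_locales auto

lemma not_le_bottom: "\<not> a \<sqsubseteq> \<bottom>" "\<not> b \<sqsubseteq> \<bottom>"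
  using crown_carrier incomparable by (meson bottom_closed bottom_lower le_trans)+

lemma not_top_le: "\<not> top_elem A \<sqsubseteq> c" "\<not> top_elem A \<sqsubseteq> d"
  using crown_carrier incomparable by (meson top_in_carrier le_top le_trans)+

lemma above_atoms_cases:
  assumes "x \<in> carrier A" "a \<sqsubseteq> x" "b \<sqsubseteq> x"
  shows "x = c \<or> x = d \<or> x = top_elem A"
  using assms carrier_eq not_le_bottom incomparable by auto

lemma below_a_cases:
  assumes "x \<in> carrier A" "x \<sqsubseteq> a"
  shows "x = \<bottom> \<or> x = a"
proof -
  have "\<not> c \<sqsubseteq> a" "\<not> d \<sqsubseteq> a" "\<not> top_elem A \<sqsubseteq> a"
    using crown_carrier below incomparable not_top_le by (meson le_trans top_in_carrier)+
  then show ?thesis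
    using assms carrier_eq incomparable by auto
qed

lemma below_b_cases: "\<lbrakk>x \<in> carrier A; x \<sqsubseteq> b\<rbrakk> \<Longrightarrow> x = \<bottom> \<or> x = b"
  using six_element_pocrim.below_a_cases[OF swap_lower] .

lemma below_atoms: "\<lbrakk>x \<in> carrier A; x \<sqsubseteq> a; x \<sqsubseteq> b\<rbrakk> \<Longrightarrow> x = \<bottom>"
  using below_a_cases incomparable by blast

lemma no_element_in_gap:
  "\<lbrakk>x \<in> carrier A; a \<sqsubseteq> x; b \<sqsubseteq> x; x \<sqsubseteq> c; x \<sqsubseteq> d\<rbrakk> \<Longrightarrow> False"
  using above_atoms_cases incomparable not_top_le by blast

lemma prod_atoms: "a \<odot> b = \<bottom>"
  using crown_carrier by (intro below_atoms prod_closed prod_le_left prod_le_right)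

lemma prod_eq_bottom_iff:
  assumes "x \<in> carrier A" "y \<in> carrier A"
  shows "x \<odot> y = \<bottom> \<longleftrightarrow> y \<sqsubseteq> x \<rightarrow> \<bottom>"
proof -
  have "x \<odot> y = \<bottom> \<longleftrightarrow> x \<odot> y \<sqsubseteq> \<bottom>"
    using assms by (metis bottom_closed bottom_lower le_antisym prod_closed)
  then show ?thesis
    using assms by (simp add: residuation)
qed

text \<open>If \<open>a \<rightarrow> \<bottom>\<close> were \<open>c\<close>, then \<open>a \<odot> d = a\<close>, and \<open>c \<odot> d\<close> collapses to \<open>a\<close>: it is above
  \<open>a\<close>, and it cannot be above \<open>b\<close> as well. This makes \<open>b\<close> annihilate \<open>d\<close>, hence not \<open>c\<close>,
  which contradicts \<open>c \<odot> b \<sqsubseteq> c \<odot> d = a\<close>.\<close>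

lemma residuum_bottom_neq: "a \<rightarrow> \<bottom> \<noteq> c"
proof
  assume ac: "a \<rightarrow> \<bottom> = c"
  note [simp] = crown_carrier prod_closed residuum_closed
  have "a \<odot> d \<noteq> \<bottom>"
    using ac incomparable by (simp add: prod_eq_bottom_iff)
  then have ad: "a \<odot> d = a"
    using below_a_cases[of "a \<odot> d"] by (simp add: prod_le_left)
  have a_cd: "a \<sqsubseteq> c \<odot> d"
    using prod_mono[of a d c d] below by (simp add: ad)
  have cd: "c \<odot> d = a"
  proof -
    have "\<not> b \<sqsubseteq> c \<odot> d"
      using a_cd no_element_in_gap[of "c \<odot> d"] by (auto simp: prod_le_left prod_le_right)
    moreover have "c \<odot> d \<noteq> c" "c \<odot> d \<noteq> d"
      using incomparable prod_le_left[of c d] prod_le_right[of c d] by auto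
    moreover have "c \<odot> d \<noteq> top_elem A"
      using prod_le_left[of c d] not_top_le by auto
    moreover have "c \<odot> d \<noteq> \<bottom>"
      using a_cd not_le_bottom by auto
    moreover have "c \<odot> d \<in> {\<bottom>, a, b, c, d, top_elem A}"
      using prod_closed[of c d] carrier_eq by simp
    ultimately show ?thesis by auto
  qed
  have bd: "b \<odot> d = \<bottom>"
  proof (rule below_atoms)
    show "b \<odot> d \<sqsubseteq> a"
      using prod_mono[of b d c d] below by (simp add: cd)
  qed (simp_all add: prod_le_left)
  have "c \<odot> b = b"
  proof -
    have "b \<odot> c \<noteq> \<bottom>"
    proof
      assume "b \<odot> c = \<bottom>"
      then have le: "c \<sqsubseteq> b \<rightarrow> \<bottom>" "d \<sqsubseteq> b \<rightarrow> \<bottom>"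
        using bd by (simp_all add: prod_eq_bottom_iff)
      then have "a \<sqsubseteq> b \<rightarrow> \<bottom>" "b \<sqsubseteq> b \<rightarrow> \<bottom>"
        using below by (meson crown_carrier bottom_closed residuum_closed le_trans)+
      then have "b \<rightarrow> \<bottom> = top_elem A"
        using above_atoms_cases[of "b \<rightarrow> \<bottom>"] le incomparable by auto
      then have "b \<odot> top_elem A = \<bottom>"
        by (simp add: prod_eq_bottom_iff top_in_carrier)
      then show False
        using not_le_bottom by (simp add: prod_top)
    qed
    then have "b \<odot> c = b"
      using below_b_cases[of "b \<odot> c"] by (simp add: prod_le_left)
    then show ?thesis by (simp add: prod_comm)
  qed
  moreover have "c \<odot> b \<sqsubseteq> c \<odot> d"
    using below by (intro prod_mono_right) simp_all
  ultimately show False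
    using cd incomparable by simp
qed

lemma atom_idempotent: "a \<odot> a = a"
proof (rule ccontr)
  note [simp] = crown_carrier prod_closed residuum_closed
  assume "a \<odot> a \<noteq> a"
  then have "a \<odot> a = \<bottom>"
    using below_a_cases[of "a \<odot> a"] by (simp add: prod_le_left)
  then have "a \<sqsubseteq> a \<rightarrow> \<bottom>" "b \<sqsubseteq> a \<rightarrow> \<bottom>"
    using prod_atoms by (simp_all add: prod_eq_bottom_iff)
  then have "a \<rightarrow> \<bottom> = top_elem A"
    using above_atoms_cases[of "a \<rightarrow> \<bottom>"] residuum_bottom_neq
      six_element_pocrim.residuum_bottom_neq[OF swap_upper] by auto
  then have "a \<odot> top_elem A = \<bottom>"
    by (simp add: prod_eq_bottom_iff top_in_carrier)
  then show False
    using not_le_bottom by (simp add: prod_top)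
qed

lemma contradiction: False
proof (rule no_element_in_gap)
  show "a \<sqsubseteq> c \<odot> d"
    using prod_mono[of a a c d] crown_carrier below by (simp add: atom_idempotent)
  show "b \<sqsubseteq> c \<odot> d"
    using prod_mono[of b b c d] crown_carrier below
    by (simp add: six_element_pocrim.atom_idempotent[OF swap_lower])
qed (use crown_carrier prod_closed prod_le_left prod_le_right in auto)

end

theorem mainTheorem2:
  fixes A :: "('a, 'b) pocrim_scheme"
  assumes "bounded_pure_residuated_multilattice A"
  shows "infinite (carrier A) \<or> 7 \<le> card (carrier A)"
proof (rule ccontr)
  interpret bounded_pure_residuated_multilattice A by (fact assms)
  assume "\<not> (infinite (carrier A) \<or> 7 \<le> card (carrier A))"
  then have fin: "finite (carrier A)" and small: "card (carrier A) \<le> 6"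
    by auto
  obtain a b c d where "crown A a b c d"
    using exists_crown by blast
  then interpret crown A a b c d .
  let ?H = "{bottom A, a, b, c, d, top_elem A}"
  have H: "?H \<subseteq> carrier A"
    using crown_carrier bottom_closed top_in_carrier by auto
  have "bottom A \<noteq> a" "bottom A \<noteq> b" "bottom A \<noteq> c" "bottom A \<noteq> d"
    using crown_carrier incomparable bottom_lower by metis+
  moreover have "top_elem A \<noteq> a" "top_elem A \<noteq> b" "top_elem A \<noteq> c" "top_elem A \<noteq> d"
    using crown_carrier incomparable le_top by metis+
  moreover have "bottom A \<noteq> top_elem A"
    using crown_carrier incomparable bottom_lower le_top le_trans bottom_closed by metis
  moreover have "a \<noteq> b" "a \<noteq> c" "a \<noteq> d" "b \<noteq> c" "b \<noteq> d" "c \<noteq> d"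
    using crown_carrier below incomparable by auto
  ultimately have "card ?H = 6"
    by auto
  then have "carrier A = ?H"
    using fin small H by (metis card_seteq)
  then interpret six_element_pocrim A a b c d
    by unfold_locales
  show False by (rule contradiction)
qed

end
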